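(* Let $\mathcal{U}\times\mathcal{V}\subseteq\mathbb{R}^n\times\mathbb{R}^m$ be an open neighborhood of the origin, and let $f:\mathcal{U}\times\mathcal{V}\to\mathbb{R}^n$ be of class $C^1$ with $f(0,0)=0$. Put $A_f:=\frac{\partial f}{\partial x}|_{(0,0)}$ and $B_f:=\frac{\partial f}{\partial u}|_{(0,0)}$. Suppose $\mathrm{cov} f(0,0)>0$ and that $f$ satisfies a type II semitransversality condition at the origin, i.e. $$\mathbb{P}_{\ker(B_f^* )^\perp}A_fA_f^*\,\mathbb{P}_{\ker(B_f^* )^\perp}=A_fA_f^*.$$ Then $\dot x=f(x,u)$ is locally exponentially stabilizable by means of continuously differentiable stationary feedback laws. Moreover, this stability is achieved by the linear feedback law $$u(x)=-\left(B_f^+A_fA_f^*(B_f^+)^*+I\right)B_f^*\left(A_fA_f^*+B_fB_f^*\right)^{-1}(I+A_f)x.$$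
   Context: All norms are Euclidean; $\mathbb{B}_r(z)$ is the closed ball of radius $r$ centered at $z$; $A^*$ is the transpose and $A^+$ the Moore-Penrose pseudoinverse of a real matrix $A$; $\mathbb{P}_V$ is the orthogonal projection onto a subspace $V$. Linear openness: a mapping $g$ into $\mathbb{R}^n$ defined near $\bar z\in\mathbb{R}^\ell$ is linearly open around $\bar z$ with modulus $\kappa>0$ if there is a neighborhood $\mathcal{W}$ of $\bar z$ such that $\mathbb{B}_{\kappa r}(g(z))\subseteq g(\mathbb{B}_r(z))$ for all $z\in\mathcal{W}$ and $r>0$ with $\mathbb{B}_r(z)\subseteq\mathcal{W}$. $\mathrm{cov}\,g(\bar z)$ denotes the supremum of all such moduli $\kappa$, with $\mathrm{cov}\,g(\bar z):=0$ if $g$ is not linearly open around $\bar z$ for any modulus. The system $\dot x=f(x,u)$ is locally exponentially stabilizable by means of continuously differentiable stationary feedback laws if there exist a $C^1$ feedback $\bar u(x)$ defined near $0\in\mathbb{R}^n$ with $\bar u(0)=0$ and constants $\alpha,M,\delta>0$ such that for every $x_0$ with $\|x_0\|<\delta$ there is a unique solution $\phi(t,x_0)$ of $\dot x=f(x,\bar u(x))$ with $\phi(0,x_0)=x_0$, and $\|\phi(t,x_0)\|\le M\|x_0\|e^{-\alpha t}$ for all $t\ge 0$. *)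

theory Defs
  imports "HOL-Analysis.Analysis"
begin

section \<open>Linear openness\<close>

text \<open>\<open>D\<close> is the domain on which \<open>g\<close> is considered.\<close>

definition linearly_open_around ::
    "'a::metric_space set \<Rightarrow> ('a \<Rightarrow> 'b::metric_space) \<Rightarrow> 'a \<Rightarrow> real \<Rightarrow> bool" where
  "linearly_open_around D g zbar \<kappa> \<longleftrightarrow>
     \<kappa> > 0 \<and>
     (\<exists>W. W \<subseteq> D \<and> zbar \<in> interior W \<and>
        (\<forall>z\<in>W. \<forall>r>0. cball z r \<subseteq> W \<longrightarrow> cball (g z) (\<kappa> * r) \<subseteq> g ` cball z r))"

text \<open>The value is extended real, since the set of moduli of a general \<open>g\<close> may be unbounded.\<close>

definition cov ::
    "'a::metric_space set \<Rightarrow> ('a \<Rightarrow> 'b::metric_space) \<Rightarrow> 'a \<Rightarrow> ereal" where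
  "cov D g zbar =
     (if \<exists>\<kappa>. linearly_open_around D g zbar \<kappa>
      then (SUP \<kappa>\<in>{\<kappa>. linearly_open_around D g zbar \<kappa>}. ereal \<kappa>)
      else 0)"

section \<open>Stabilizability by continuously differentiable feedback\<close>

definition C1_on ::
    "'a::real_normed_vector set \<Rightarrow> ('a \<Rightarrow> 'b::real_normed_vector) \<Rightarrow> bool" where
  "C1_on S g \<longleftrightarrow>
     (\<exists>g'. (\<forall>x\<in>S. (g has_derivative blinfun_apply (g' x)) (at x)) \<and> continuous_on S g')"

text \<open>\<open>\<phi>\<close> solves \<open>\<phi>' = F \<phi>\<close> on the time interval \<open>J\<close> and stays in the domain \<open>N\<close> of \<open>F\<close>;
  derivatives at endpoints of \<open>J\<close> are one-sided.\<close>

definition is_solution ::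
    "('a::real_normed_vector \<Rightarrow> 'a) \<Rightarrow> 'a set \<Rightarrow> real set \<Rightarrow> (real \<Rightarrow> 'a) \<Rightarrow> bool" where
  "is_solution F N J \<phi> \<longleftrightarrow>
     (\<forall>t\<in>J. \<phi> t \<in> N \<and> (\<phi> has_vector_derivative F (\<phi> t)) (at t within J))"

text \<open>\<open>N\<close> is the neighborhood of the origin on which the feedback \<open>ubar\<close> is used. Uniqueness of the
  solution \<open>\<phi>\<close> is required on every forward time interval, so that it covers \<open>[0, \<infinity>)\<close> as
  well as solutions that exist only for a finite time.\<close>

definition exp_stabilizes ::
    "'a::real_normed_vector set \<Rightarrow> 'b::real_normed_vector set \<Rightarrow> ('a \<times> 'b \<Rightarrow> 'a) \<Rightarrow>
     ('a \<Rightarrow> 'b) \<Rightarrow> bool" where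
  "exp_stabilizes U V f ubar \<longleftrightarrow>
     (\<exists>N. open N \<and> 0 \<in> N \<and> N \<subseteq> U \<and> ubar ` N \<subseteq> V \<and> C1_on N ubar \<and> ubar 0 = 0 \<and>
       (\<exists>\<alpha> M \<delta>. \<alpha> > 0 \<and> M > 0 \<and> \<delta> > 0 \<and>
         (\<forall>x0. norm x0 < \<delta> \<longrightarrow>
           (\<exists>\<phi>. is_solution (\<lambda>x. f (x, ubar x)) N {0..} \<phi> \<and> \<phi> 0 = x0 \<and>
              (\<forall>J \<psi>. is_interval J \<and> 0 \<in> J \<and> J \<subseteq> {0..} \<and>
                  is_solution (\<lambda>x. f (x, ubar x)) N J \<psi> \<and> \<psi> 0 = x0 \<longrightarrow>
                  (\<forall>t\<in>J. \<psi> t = \<phi> t)) \<and>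
              (\<forall>t\<ge>0. norm (\<phi> t) \<le> M * norm x0 * exp (- \<alpha> * t))))))"

definition locally_exp_stabilizable ::
    "'a::real_normed_vector set \<Rightarrow> 'b::real_normed_vector set \<Rightarrow> ('a \<times> 'b \<Rightarrow> 'a) \<Rightarrow> bool" where
  "locally_exp_stabilizable U V f \<longleftrightarrow> (\<exists>ubar. exp_stabilizes U V f ubar)"

section \<open>Orthogonal projections and the Moore--Penrose pseudoinverse\<close>

definition orth_proj :: "(real^'n) set \<Rightarrow> real^'n^'n" where
  "orth_proj S = matrix (\<lambda>x. THE p. p \<in> S \<and> x - p \<in> S\<^sup>\<bottom>)"

definition kernel :: "real^'n^'m \<Rightarrow> (real^'n) set" where
  "kernel A = {x. A *v x = 0}"

definition is_pseudoinverse :: "real^'n^'m \<Rightarrow> real^'m^'n \<Rightarrow> bool" where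
  "is_pseudoinverse A X \<longleftrightarrow>
     A ** X ** A = A \<and> X ** A ** X = X \<and>
     transpose (A ** X) = A ** X \<and> transpose (X ** A) = X ** A"

definition pseudoinverse :: "real^'n^'m \<Rightarrow> real^'m^'n" where
  "pseudoinverse A = (THE X. is_pseudoinverse A X)"

lemma orth_proj_ex1:
  fixes S :: "'a::euclidean_space set"
  assumes "subspace S"
  shows "\<exists>!p. p \<in> S \<and> x - p \<in> S\<^sup>\<bottom>"
proof (rule ex_ex1I)
  obtain y z where yz: "y \<in> span S" "\<And>w. w \<in> span S \<Longrightarrow> orthogonal z w" "x = y + z"
    using orthogonal_subspace_decomp_exists[of S x] by blast
  have "span S = S" using assms by (simp add: span_eq_iff)
  then have "y \<in> S" "\<And>w. w \<in> S \<Longrightarrow> orthogonal w z"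
    using yz(1,2) by (auto simp only: orthogonal_commute[of _ z])
  then show "\<exists>p. p \<in> S \<and> x - p \<in> S\<^sup>\<bottom>"
    using yz(3) by (intro exI[of _ y]) (auto simp: orthogonal_comp_def)
next
  fix p q assume "p \<in> S \<and> x - p \<in> S\<^sup>\<bottom>" "q \<in> S \<and> x - q \<in> S\<^sup>\<bottom>"
  then have "p - q \<in> S" "(p - q) \<bullet> (x - p) = 0" "(p - q) \<bullet> (x - q) = 0"
    using assms by (auto simp: orthogonal_comp_def orthogonal_def subspace_diff)
  then have "(p - q) \<bullet> (p - q) = 0"
    by (simp add: inner_diff_right)
  then show "p = q" by simp
qed

lemma orth_proj_works:
  fixes S :: "(real^'n) set"
  assumes "subspace S"
  shows "orth_proj S *v x \<in> S" "x - orth_proj S *v x \<in> S\<^sup>\<bottom>"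
proof -
  define P where "P = (\<lambda>x. THE p. p \<in> S \<and> x - p \<in> S\<^sup>\<bottom>)"
  have P: "P x \<in> S \<and> x - P x \<in> S\<^sup>\<bottom>" for x
    unfolding P_def by (rule theI'[OF orth_proj_ex1[OF assms]])
  have uniq: "P x = p" if "p \<in> S" "x - p \<in> S\<^sup>\<bottom>" for x p
    using P[of x] that orth_proj_ex1[OF assms, of x] by blast
  have sc: "subspace (S\<^sup>\<bottom>)" by (rule subspace_orthogonal_comp)
  have "linear P"
  proof (rule linearI)
    fix x y show "P (x + y) = P x + P y"
      using P[of x] P[of y] subspace_add[OF sc, of "x - P x" "y - P y"]
      by (intro uniq) (auto simp: subspace_add[OF assms] algebra_simps)
  next
    fix c x show "P (c *\<^sub>R x) = c *\<^sub>R P x"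
      using P[of x] subspace_scale[OF sc, of "x - P x" c]
      by (intro uniq) (auto simp: subspace_scale[OF assms] algebra_simps)
  qed
  then have "orth_proj S *v x = P x"
    unfolding orth_proj_def P_def[symmetric] by simp
  then show "orth_proj S *v x \<in> S" "x - orth_proj S *v x \<in> S\<^sup>\<bottom>"
    using P[of x] by auto
qed

lemma pseudoinverse_unique:
  assumes "is_pseudoinverse A X" "is_pseudoinverse A Y"
  shows "X = Y"
proof -
  have X: "A ** X ** A = A" "X ** A ** X = X" "transpose (A ** X) = A ** X"
      "transpose (X ** A) = X ** A"
    and Y: "A ** Y ** A = A" "Y ** A ** Y = Y" "transpose (A ** Y) = A ** Y"
      "transpose (Y ** A) = Y ** A"
    using assms by (auto simp: is_pseudoinverse_def)
  have "A ** Y = (A ** X) ** (A ** Y)" by (simp add: matrix_mul_assoc X(1))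
  then have "transpose (A ** Y) = transpose (A ** Y) ** transpose (A ** X)"
    using matrix_transpose_mul[of "A ** X" "A ** Y"] by simp
  then have "A ** Y = (A ** Y) ** (A ** X)" unfolding X(3) Y(3) .
  then have 1: "A ** Y = A ** X" by (simp add: matrix_mul_assoc Y(1))
  have "Y ** A = (Y ** A) ** (X ** A)"
    using X(1) by (simp add: matrix_mul_assoc[symmetric])
  then have "transpose (Y ** A) = transpose (X ** A) ** transpose (Y ** A)"
    using matrix_transpose_mul[of "Y ** A" "X ** A"] by simp
  then have "Y ** A = (X ** A) ** (Y ** A)" unfolding X(4) Y(4) .
  then have 2: "Y ** A = X ** A"
    using Y(1) by (simp add: matrix_mul_assoc[symmetric])
  have "X = X ** (A ** Y)" unfolding 1 using X(2) by (simp add: matrix_mul_assoc)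
  also have "\<dots> = Y"
    unfolding matrix_mul_assoc 2[symmetric] using Y(2) .
  finally show ?thesis .
qed

lemma pseudoinverse_exists:
  fixes A :: "real^'n^'m"
  shows "\<exists>X. is_pseudoinverse A X"
proof -
  define R where "R = range (\<lambda>x. A *v x)"
  define K where "K = kernel A"
  have sR: "subspace R"
    unfolding R_def by (intro linear_subspace_image matrix_vector_mul_linear subspace_UNIV)
  have sK: "subspace K"
    unfolding K_def kernel_def
    by (auto simp: subspace_def matrix_vector_right_distrib matrix_vector_mult_scaleR)
  have sC: "subspace (K\<^sup>\<bottom>)" by (rule subspace_orthogonal_comp)
  define P where "P = orth_proj R"
  define Q where "Q = orth_proj (K\<^sup>\<bottom>)"
  have AQ: "A *v (Q *v x) = A *v x" for x
  proof -
    have "x - Q *v x \<in> K"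
      using orth_proj_works(2)[OF sC, of x] orthogonal_comp_self[of K] sK by (simp add: Q_def)
    then show ?thesis by (simp add: K_def kernel_def matrix_vector_mult_diff_distrib)
  qed
  have inj: "x = y" if "x \<in> K\<^sup>\<bottom>" "y \<in> K\<^sup>\<bottom>" "A *v x = A *v y" for x y
  proof -
    have "x - y \<in> K" using that by (simp add: K_def kernel_def matrix_vector_mult_diff_distrib)
    moreover have "x - y \<in> K\<^sup>\<bottom>" using that sC by (simp add: subspace_diff)
    ultimately have "(x - y) \<bullet> (x - y) = 0" by (auto simp: orthogonal_comp_def orthogonal_def)
    then show ?thesis by simp
  qed
  have "\<exists>x. x \<in> K\<^sup>\<bottom> \<and> A *v x = P *v y" for y
  proof -
    obtain z where "P *v y = A *v z"
      using orth_proj_works(1)[OF sR, of y] by (auto simp: P_def R_def)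
    then show ?thesis
      using AQ[of z] orth_proj_works(1)[OF sC, of z] by (intro exI[of _ "Q *v z"]) (simp add: Q_def)
  qed
  then obtain g where g: "g y \<in> K\<^sup>\<bottom>" "A *v g y = P *v y" for y by metis
  have "linear g"
    by (rule linearI; rule inj)
       (simp_all add: g subspace_add subspace_scale sC matrix_vector_right_distrib
          matrix_vector_mult_scaleR)
  then have gX: "matrix g *v y = g y" for y by simp
  have PA: "P *v (A *v x) = A *v x" for x
  proof -
    have "P *v (A *v x) \<in> R" "A *v x - P *v (A *v x) \<in> R\<^sup>\<bottom>" "A *v x \<in> R"
      using orth_proj_works[OF sR] by (auto simp: P_def R_def)
    moreover have "0 \<in> R\<^sup>\<bottom>" by (simp add: subspace_0 subspace_orthogonal_comp)
    ultimately show ?thesis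
      using orth_proj_ex1[OF sR, of "A *v x"] by (metis diff_self)
  qed
  have QK: "Q *v x \<in> K\<^sup>\<bottom>" for x
    using orth_proj_works(1)[OF sC] by (simp add: Q_def)
  have gA: "g (A *v x) = Q *v x" for x
    by (rule inj) (simp_all add: g AQ PA QK)
  have sym: "transpose (orth_proj S) = orth_proj S" if "subspace S" for S :: "(real^'k) set"
  proof -
    note p = orth_proj_works[OF that]
    have "(orth_proj S *v x) \<bullet> y = x \<bullet> (orth_proj S *v y)" for x y
    proof -
      have "(orth_proj S *v x) \<bullet> (y - orth_proj S *v y) = 0"
           "(orth_proj S *v y) \<bullet> (x - orth_proj S *v x) = 0"
        using p[of x] p[of y] by (auto simp: orthogonal_comp_def orthogonal_def)
      then show ?thesis by (simp add: inner_diff_right inner_commute)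
    qed
    then have "x \<bullet> (transpose (orth_proj S) *v y) = x \<bullet> (orth_proj S *v y)" for x y
      using dot_lmul_matrix[of y "orth_proj S" x]
      by (simp add: transpose_matrix_vector inner_commute)
    then have "transpose (orth_proj S) *v y = orth_proj S *v y" for y
      using vector_eq_ldot by blast
    then show ?thesis by (simp add: matrix_eq del: transpose_matrix_vector)
  qed
  have AX: "A ** matrix g = P" and XA: "matrix g ** A = Q"
    by (simp_all add: matrix_eq matrix_vector_mul_assoc[symmetric] gX g gA)
  have "P ** A = A" by (simp add: matrix_eq matrix_vector_mul_assoc[symmetric] PA)
  moreover have "Q ** matrix g = matrix g"
  proof -
    have "Q *v g y = g y" for y
      by (rule inj) (simp_all add: g AQ QK)
    then show ?thesis by (simp add: matrix_eq matrix_vector_mul_assoc[symmetric] gX)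
  qed
  ultimately have "is_pseudoinverse A (matrix g)"
    using sym[OF sR] sym[OF sC] by (simp add: is_pseudoinverse_def AX XA P_def Q_def)
  then show ?thesis ..
qed

lemma is_pseudoinverse_pseudoinverse: "is_pseudoinverse A (pseudoinverse A)"
  unfolding pseudoinverse_def
  by (rule theI') (use pseudoinverse_exists pseudoinverse_unique in blast)

end

theory Submission
  imports Defs
begin

text \<open>Testing openness at the origin against a vector orthogonal to the range of the derivative shows
  that \<open>(x, u) \<mapsto> A x + B u\<close> is onto. Semitransversality puts the range of \<open>A\<close> into that of \<open>B\<close>, so
  \<open>B\<close> itself is onto and \<open>B B\<^sup>+ = I\<close>. For the feedback \<open>u = - K x\<close> this gives \<open>B K = I + A\<close>: the
  linearized closed loop is \<open>x' = - x\<close>, so near the origin the closed loop is a perturbation of it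
  with small Lipschitz constant.\<close>

section \<open>Linear openness and the range of the derivative\<close>

text \<open>Openness forces \<open>g\<close> to move by \<open>\<kappa> * r\<close> in the direction
  of \<open>y\<close> within distance \<open>r\<close> of \<open>z\<close>. The derivative
  contributes nothing in that direction, so the whole displacement would be first-order error, which
  is too small.\<close>

lemma linearly_open_orthogonal_range:
  fixes g :: "'a::real_normed_vector \<Rightarrow> 'b::real_inner"
  assumes open_g: "linearly_open_around D g z \<kappa>"
    and der: "(g has_derivative g') (at z)"
    and orth: "\<And>x. y \<bullet> g' x = 0"
  shows "y = 0"
proof (rule ccontr)
  assume "y \<noteq> 0"
  from open_g obtain W where k: "\<kappa> > 0" and W: "z \<in> interior W"
    "\<And>w r. w \<in> W \<Longrightarrow> r > 0 \<Longrightarrow> cball w r \<subseteq> W \<Longrightarrow> cball (g w) (\<kappa> * r) \<subseteq> g ` cball w r"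
    unfolding linearly_open_around_def by blast
  \<comment> \<open>The accuracy \<open>\<kappa> / 2\<close> is below the modulus
    \<open>\<kappa>\<close>, which yields the final contradiction.\<close>
  obtain d where d: "d > 0"
    "\<And>w. norm (w - z) < d \<Longrightarrow> norm (g w - g z - g' (w - z)) \<le> \<kappa> / 2 * norm (w - z)"
    using der k unfolding has_derivative_at_alt by (meson half_gt_zero)
  obtain e where e: "e > 0" "cball z e \<subseteq> W"
    using W(1) by (meson interior_subset open_contains_cball open_interior order_trans)
  define r where "r = min e (d / 2)"
  have r: "r > 0" "r < d" "cball z r \<subseteq> W"
    using d(1) e by (auto simp: r_def)
  \<comment> \<open>Scaled to norm exactly \<open>\<kappa> * r\<close>, so \<open>g z + v\<close> is
    an extreme point of the ball that openness covers.\<close>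
  define v where "v = (\<kappa> * r / norm y) *\<^sub>R y"
  have "g z + v \<in> cball (g z) (\<kappa> * r)"
    using \<open>y \<noteq> 0\<close> k r by (simp add: v_def dist_norm)
  moreover have "z \<in> W" using W(1) interior_subset by blast
  ultimately obtain w where w: "w \<in> cball z r" "g w = g z + v"
    using W(2)[of z r] r by (metis imageE subsetD)
  then have nw: "norm (w - z) \<le> r" by (simp add: dist_norm norm_minus_commute)
  have "norm (v - g' (w - z)) \<le> \<kappa> / 2 * norm (w - z)"
    using d(2)[of w] nw r w(2) by simp
  also have "\<dots> \<le> \<kappa> / 2 * r" using nw k by simp
  finally have *: "norm (v - g' (w - z)) \<le> \<kappa> / 2 * r" .
  have "\<kappa> * r * norm y = y \<bullet> (v - g' (w - z))"
    using \<open>y \<noteq> 0\<close> orth[of "w - z"]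
    by (simp add: inner_diff_right v_def dot_square_norm power2_eq_square)
  also have "\<dots> \<le> norm y * norm (v - g' (w - z))" by (rule norm_cauchy_schwarz)
  also have "\<dots> \<le> norm y * (\<kappa> / 2 * r)" by (rule mult_left_mono[OF * norm_ge_zero])
  finally show False using \<open>y \<noteq> 0\<close> k r(1) by simp
qed

lemma cov_pos_imp_linearly_open:
  assumes "cov D g z > 0"
  shows "\<exists>\<kappa>. linearly_open_around D g z \<kappa>"
proof (rule ccontr)
  assume "\<nexists>\<kappa>. linearly_open_around D g z \<kappa>"
  then have "cov D g z = 0" by (simp add: cov_def)
  with assms show False by simp
qed

section \<open>Decay, existence and uniqueness for perturbations of \<open>x' = - x\<close>\<close>

text \<open>The weighted energy \<open>E\<close> is nonincreasing. Applied to a solution this gives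
  decay; applied to the difference of two solutions with equal initial value it gives uniqueness,
  which is why \<open>J\<close> is a general forward interval.\<close>

lemma exp_decay_of_dissipative:
  fixes w :: "real \<Rightarrow> 'a::real_inner"
  assumes J: "is_interval J" "0 \<in> J" "J \<subseteq> {0..}"
    and der: "\<And>s. s \<in> J \<Longrightarrow> (w has_vector_derivative w' s) (at s within J)"
    and diss: "\<And>s. s \<in> J \<Longrightarrow> w s \<bullet> w' s \<le> - c * (w s \<bullet> w s)"
    and t: "t \<in> J"
  shows "norm (w t) \<le> norm (w 0) * exp (- c * t)"
proof -
  define E where "E = (\<lambda>s. exp (2 * c * s) * (w s \<bullet> w s))"
  have E: "(E has_real_derivative
      exp (2 * c * s) * (2 * (w s \<bullet> w' s)) + 2 * c * exp (2 * c * s) * (w s \<bullet> w s)) (at s within J)"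
    if "s \<in> J" for s
    using der[OF that] unfolding E_def has_vector_derivative_def has_field_derivative_def
    by (auto intro!: derivative_eq_intros simp: fun_eq_iff inner_commute algebra_simps)
  have t0: "0 \<le> t" and sub: "{0..t} \<subseteq> J"
    using J t by (auto intro: mem_is_interval_1_I[OF J(1,2) t])
  have "E t \<le> E 0"
  proof (rule DERIV_nonpos_imp_decreasing_open[OF t0])
    fix s assume s: "0 < s" "s < t"
    then have "s \<in> J" using sub by auto
    \<comment> \<open>Strictly between \<open>0\<close> and \<open>t\<close> the derivative within
      \<open>J\<close> is two-sided, as the monotonicity criterion requires; the endpoints need only
      continuity.\<close>
    have "at s within J = at s"
      using s sub by (intro at_within_interior) (auto simp: interior_def intro!: exI[of _ "{0<..<t}"])
    moreover have "exp (2 * c * s) * (2 * (w s \<bullet> w' s)) + 2 * c * exp (2 * c * s) * (w s \<bullet> w s)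
        = 2 * exp (2 * c * s) * (w s \<bullet> w' s + c * (w s \<bullet> w s))"
      by (simp add: algebra_simps)
    then have "exp (2 * c * s) * (2 * (w s \<bullet> w' s)) + 2 * c * exp (2 * c * s) * (w s \<bullet> w s) \<le> 0"
      using diss[OF \<open>s \<in> J\<close>] by (simp add: mult_le_0_iff)
    ultimately show "\<exists>y. (E has_real_derivative y) (at s) \<and> y \<le> 0"
      using E[OF \<open>s \<in> J\<close>] by auto
  next
    show "continuous_on {0..t} E"
      by (rule continuous_on_subset[OF DERIV_continuous_on[OF E] sub])
  qed
  then have "(exp (c * t) * norm (w t))\<^sup>2 \<le> (norm (w 0))\<^sup>2"
    by (simp add: E_def power_mult_distrib dot_square_norm flip: exp_double mult.assoc)
  then have "exp (c * t) * norm (w t) \<le> norm (w 0)"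
    by (rule power2_le_imp_le) simp
  then show ?thesis
    by (simp add: exp_minus field_simps)
qed

text \<open>Near \<open>t\<close> the half-line coincides with the compact interval
  \<open>{0..t+1}\<close>, where the fundamental theorem of calculus applies.\<close>

lemma indefinite_integral_has_vector_derivative:
  fixes g :: "real \<Rightarrow> 'a::banach"
  assumes "continuous_on UNIV g" "0 \<le> t"
  shows "((\<lambda>u. integral {0..u} g) has_vector_derivative g t) (at t within {0..})"
proof -
  have "((\<lambda>u. integral {0..u} g) has_vector_derivative g t) (at t within {0..t+1})"
    using assms by (intro integral_has_vector_derivative) (auto intro: continuous_on_subset)
  moreover have "at t within {0..t+1} = at t within {0..}"
    by (rule at_within_nhd[of _ "{..<t+1}"]) auto
  ultimately show ?thesis by simp
qed

text \<open>The bound is uniform in \<open>t\<close> because the weight integrates to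
  \<open>1 - exp (- t)\<close>. It serves both for boundedness of the integral operator below and
  for its contraction estimate.\<close>

lemma norm_integral_exp_weighted_le:
  fixes k :: "real \<Rightarrow> 'a::banach"
  assumes "continuous_on UNIV k" "\<And>s. norm (k s) \<le> C" "0 \<le> t"
  shows "norm (exp (- t) *\<^sub>R integral {0..t} (\<lambda>s. exp s *\<^sub>R k s)) \<le> C"
proof -
  have C: "0 \<le> C" using assms(2) norm_ge_zero order_trans by blast
  have I: "((\<lambda>s. C * exp s) has_integral (C * exp t - C * exp 0)) {0..t}"
    by (rule fundamental_theorem_of_calculus)
       (auto intro!: derivative_eq_intros assms simp flip: has_real_derivative_iff_has_vector_derivative)
  have "norm (integral {0..t} (\<lambda>s. exp s *\<^sub>R k s)) \<le> integral {0..t} (\<lambda>s. C * exp s)"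
    using I assms(2)
    by (intro integral_norm_bound_integral)
       (auto intro!: integrable_continuous_interval continuous_intros
          continuous_on_subset[OF assms(1)] simp: mult.commute intro: mult_right_mono)
  also have "\<dots> = C * exp t - C" using integral_unique[OF I] by simp
  also have "\<dots> \<le> C * exp t" using C by simp
  finally show ?thesis by (simp add: exp_minus field_simps)
qed

text \<open>By variation of constants a solution is a fixed point of
  \<open>\<phi> \<mapsto> e\<^sup>-\<^sup>t (x\<^sub>0 + \<integral>\<^sub>0\<^sup>t e\<^sup>s H(\<phi>(s)) ds)\<close>; since \<open>e\<^sup>-\<^sup>t \<integral>\<^sub>0\<^sup>t e\<^sup>s ds \<le> 1\<close>, this map contracts the
  supremum norm on the whole half-line, so no continuation argument is needed.\<close>

lemma lipschitz_perturbation_solution_exists: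
  fixes H :: "'a::banach \<Rightarrow> 'a"
  assumes lip: "c-lipschitz_on UNIV H" and c: "c < 1"
  shows "\<exists>\<phi>. \<phi> 0 = x0 \<and>
    (\<forall>t\<ge>0. (\<phi> has_vector_derivative - \<phi> t + H (\<phi> t)) (at t within {0..}))"
proof -
  have c0: "0 \<le> c" using lip lipschitz_on_def by blast
  have L: "norm (H x - H y) \<le> c * norm (x - y)" for x y
    using lipschitz_onD[OF lip, of x y] by (simp add: dist_norm)
  have H[continuous_intros]: "continuous_on T (\<lambda>s. H (p s))" if "continuous_on T p" for T :: "real set" and p
    using continuous_on_compose2[OF lipschitz_on_continuous_on[OF lip] that] by auto
  define \<Phi> where "\<Phi> = (\<lambda>p t. exp (- t) *\<^sub>R (x0 + integral {0..t} (\<lambda>s. exp s *\<^sub>R H (p s))))"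
  have der: "(\<Phi> p has_vector_derivative - \<Phi> p t + H (p t)) (at t within {0..})"
    if "continuous_on UNIV p" "0 \<le> t" for p t
    unfolding \<Phi>_def
    by (rule derivative_eq_intros indefinite_integral_has_vector_derivative refl that continuous_intros
         | simp add: that algebra_simps flip: exp_add scaleR_add_right)+
  \<comment> \<open>Freezing the value at negative times makes the image a function on all of the
    real line, so that the operator acts on the complete space of bounded continuous
    functions.\<close>
  define S where "S = (\<lambda>p::real \<Rightarrow>\<^sub>C 'a. \<lambda>t. \<Phi> (apply_bcontfun p) (max 0 t))"
  have cont: "continuous_on UNIV (apply_bcontfun p)" for p :: "real \<Rightarrow>\<^sub>C 'a"
    by (rule continuous_on_apply_bcontfun)
  have "S p \<in> bcontfun" for p
  proof (rule bcontfun_normI)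
    have "continuous_on {0..} (\<Phi> (apply_bcontfun p))"
      using der[OF cont] has_vector_derivative_continuous
      by (fastforce simp: continuous_on_eq_continuous_within)
    then show "continuous_on UNIV (S p)"
      unfolding S_def by (rule continuous_on_compose2) (auto intro!: continuous_intros)
    fix t
    have "norm (H (p s)) \<le> norm (H 0) + c * norm p" for s
    proof -
      have "norm (H (p s)) \<le> norm (H 0) + norm (H (p s) - H 0)" by (metis add.commute diff_add_cancel norm_triangle_ineq)
      also have "\<dots> \<le> norm (H 0) + c * norm (p s)" using L[of "p s" 0] by simp
      also have "\<dots> \<le> norm (H 0) + c * norm p" using c0 norm_bounded[of p s] by (simp add: mult_left_mono)
      finally show ?thesis .
    qed
    then have "norm (exp (- max 0 t) *\<^sub>R integral {0..max 0 t} (\<lambda>s. exp s *\<^sub>R H (p s))) \<le> norm (H 0) + c * norm p"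
      by (intro norm_integral_exp_weighted_le) (auto intro!: continuous_intros cont)
    moreover have "norm (exp (- max 0 t) *\<^sub>R x0) \<le> norm x0"
      by (simp add: mult_left_le_one_le)
    ultimately show "norm (S p t) \<le> norm x0 + (norm (H 0) + c * norm p)"
      unfolding S_def \<Phi>_def scaleR_add_right by (meson add_mono norm_triangle_le)
  qed
  then have app: "apply_bcontfun (Bcontfun (S p)) = S p" for p
    by (simp add: Bcontfun_inverse)
  have "dist (Bcontfun (S p)) (Bcontfun (S q)) \<le> c * dist p q" for p q
  proof (rule dist_bound)
    fix t :: real
    define u where "u = max 0 t"
    have int: "(\<lambda>s. exp s *\<^sub>R H (apply_bcontfun r s)) integrable_on {0..u}" for r
      by (intro integrable_continuous_interval continuous_intros continuous_on_subset[OF cont]) auto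
    have "S p t - S q t = exp (- u) *\<^sub>R
        (integral {0..u} (\<lambda>s. exp s *\<^sub>R H (p s)) - integral {0..u} (\<lambda>s. exp s *\<^sub>R H (q s)))"
      by (simp add: S_def \<Phi>_def u_def algebra_simps)
    also have "\<dots> = exp (- u) *\<^sub>R integral {0..u} (\<lambda>s. exp s *\<^sub>R (H (p s) - H (q s)))"
      by (subst Henstock_Kurzweil_Integration.integral_diff[symmetric]) (simp_all add: int scaleR_diff_right)
    also have "norm \<dots> \<le> c * dist p q"
    proof (rule norm_integral_exp_weighted_le)
      fix s
      have "norm (H (p s) - H (q s)) \<le> c * dist (p s) (q s)" using L by (simp add: dist_norm)
      also have "\<dots> \<le> c * dist p q" using c0 by (simp add: mult_left_mono dist_bounded)
      finally show "norm (H (p s) - H (q s)) \<le> c * dist p q" .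
    qed (auto simp: u_def intro!: continuous_intros cont)
    finally show "dist (Bcontfun (S p) t) (Bcontfun (S q) t) \<le> c * dist p q"
      by (simp add: app dist_norm)
  qed
  then obtain p where p: "Bcontfun (S p) = p"
    using banach_fix_type[OF c0 c, of "\<lambda>p. Bcontfun (S p)"] by blast
  then have Sp: "apply_bcontfun p = S p" by (metis app)
  have fix_p: "apply_bcontfun p t = \<Phi> p t" if "0 \<le> t" for t
    using that fun_cong[OF Sp, of t] by (simp add: S_def)
  have "(apply_bcontfun p has_vector_derivative - p t + H (p t)) (at t within {0..})" if "0 \<le> t" for t
    \<comment> \<open>\<open>p\<close> and \<open>\<Phi> p\<close> agree only at nonnegative times;
      this suffices for derivatives within \<open>{0..}\<close>.\<close>
    using der[OF cont[of p] that]
    by (rule has_vector_derivative_transform[rotated 2, THEN has_vector_derivative_eq_rhs])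
       (use that fix_p in auto)
  moreover have "p 0 = x0" by (simp add: fix_p \<Phi>_def)
  ultimately show ?thesis by blast
qed

text \<open>Composing \<open>x \<mapsto> F x + x\<close> with the projection onto the ball extends it to a global contraction,
  to which the previous lemma applies; the decay of the solution keeps it inside the ball.\<close>

lemma exp_stable_near_minus_identity:
  fixes F :: "'a::euclidean_space \<Rightarrow> 'a"
  assumes lip: "(1/2)-lipschitz_on (cball 0 \<rho>) (\<lambda>x. F x + x)" and F0: "F 0 = 0" and x0: "norm x0 < \<rho>"
  shows "\<exists>\<phi>. is_solution F (ball 0 \<rho>) {0..} \<phi> \<and> \<phi> 0 = x0 \<and>
    (\<forall>J \<psi>. is_interval J \<and> 0 \<in> J \<and> J \<subseteq> {0..} \<and> is_solution F (ball 0 \<rho>) J \<psi> \<and> \<psi> 0 = x0 \<longrightarrow>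
       (\<forall>t\<in>J. \<psi> t = \<phi> t)) \<and>
    (\<forall>t\<ge>0. norm (\<phi> t) \<le> norm x0 * exp (- (1/2) * t))"
proof -
  have \<rho>: "0 < \<rho>" using x0 norm_ge_zero[of x0] by linarith
  define H where "H = (\<lambda>x. F (closest_point (cball 0 \<rho>) x) + closest_point (cball 0 \<rho>) x)"
  have HF: "H x = F x + x" if "x \<in> cball 0 \<rho>" for x
    using that by (simp add: H_def closest_point_self)
  have L: "norm (H x - H y) \<le> 1/2 * norm (x - y)" for x y
  proof -
    have ne: "cball (0::'a) \<rho> \<noteq> {}" using \<rho> by simp
    have "closest_point (cball 0 \<rho>) z \<in> cball 0 \<rho>" for z :: 'a
      by (rule closest_point_in_set[OF closed_cball ne])
    then have "norm (H x - H y) \<le> 1/2 * dist (closest_point (cball 0 \<rho>) x) (closest_point (cball 0 \<rho>) y)"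
      using lipschitz_onD[OF lip] by (simp add: H_def dist_norm)
    also have "\<dots> \<le> 1/2 * dist x y"
      using closest_point_lipschitz[OF convex_cball closed_cball ne, of x y] by simp
    finally show ?thesis by (simp add: dist_norm)
  qed
  have "(1/2)-lipschitz_on UNIV H" using L by (auto intro!: lipschitz_onI simp: dist_norm)
  then obtain \<phi> where \<phi>: "\<phi> 0 = x0"
    "\<And>t. 0 \<le> t \<Longrightarrow> (\<phi> has_vector_derivative - \<phi> t + H (\<phi> t)) (at t within {0..})"
    using lipschitz_perturbation_solution_exists[of "1/2" H x0] by auto
  \<comment> \<open>The linear part contributes minus the squared distance and the perturbation at
    most half of it, leaving the rate \<open>1/2\<close>.\<close>
  have diss: "(x - y) \<bullet> ((- x + H x) - (- y + H y)) \<le> - (1/2) * ((x - y) \<bullet> (x - y))" for x y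
  proof -
    have "(x - y) \<bullet> (H x - H y) \<le> norm (x - y) * norm (H x - H y)" by (rule norm_cauchy_schwarz)
    also have "\<dots> \<le> norm (x - y) * (1/2 * norm (x - y))" by (intro mult_left_mono L) simp
    finally have "(x - y) \<bullet> (H x - H y) \<le> 1/2 * ((x - y) \<bullet> (x - y))"
      by (simp add: dot_square_norm power2_eq_square)
    moreover have "(- x + H x) - (- y + H y) = (H x - H y) - (x - y)" by simp
    ultimately show ?thesis by (simp only: inner_diff_right[of "x - y" "H x - H y"])
  qed
  \<comment> \<open>The origin is thus an equilibrium, and \<open>diss\<close> with
    \<open>y = 0\<close> bounds the solution itself.\<close>
  have "H 0 = 0" using HF[of 0] F0 \<rho> by simp
  then have decay: "norm (\<phi> t) \<le> norm x0 * exp (- (1/2) * t)" if "0 \<le> t" for t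
    using exp_decay_of_dissipative[of "{0..}" \<phi> "\<lambda>s. - \<phi> s + H (\<phi> s)" "1/2" t]
      \<phi> diss[of _ 0] that by (auto simp: is_interval_ci)
  \<comment> \<open>The solution never leaves the ball on which \<open>H\<close> is the original
    perturbation, so it also solves the original equation.\<close>
  have stay: "norm (\<phi> t) < \<rho>" if "0 \<le> t" for t
  proof -
    have "norm x0 * exp (- (1/2) * t) \<le> norm x0" using that by (intro mult_left_le) auto
    then show ?thesis using decay[OF that] x0 by linarith
  qed
  have sol: "is_solution F (ball 0 \<rho>) {0..} \<phi>"
    using \<phi>(2) stay HF by (auto simp: is_solution_def less_imp_le)
  have uniq: "\<psi> t = \<phi> t" if J: "is_interval J" "0 \<in> J" "J \<subseteq> {0..}"
    and \<psi>: "is_solution F (ball 0 \<rho>) J \<psi>" "\<psi> 0 = x0" and t: "t \<in> J" for J \<psi> t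
  proof -
    \<comment> \<open>Inside the ball \<open>\<psi>\<close> solves the extended equation too, and
      the difference starts at zero.\<close>
    have "norm (\<psi> t - \<phi> t) \<le> norm (\<psi> 0 - \<phi> 0) * exp (- (1/2) * t)"
    proof (rule exp_decay_of_dissipative[OF J, where w = "\<lambda>s. \<psi> s - \<phi> s"])
      fix s assume s: "s \<in> J"
      have "\<psi> s \<in> ball 0 \<rho>" "(\<psi> has_vector_derivative F (\<psi> s)) (at s within J)"
        using \<psi>(1) s by (auto simp: is_solution_def)
      moreover from this(1) have "F (\<psi> s) = - \<psi> s + H (\<psi> s)" by (simp add: HF)
      moreover have "(\<phi> has_vector_derivative - \<phi> s + H (\<phi> s)) (at s within J)"
        using \<phi>(2)[of s] s J(3) by (auto intro: has_vector_derivative_within_subset)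
      ultimately show "((\<lambda>s. \<psi> s - \<phi> s) has_vector_derivative
          (- \<psi> s + H (\<psi> s)) - (- \<phi> s + H (\<phi> s))) (at s within J)"
        by (auto intro: has_vector_derivative_diff)
      show "(\<psi> s - \<phi> s) \<bullet> ((- \<psi> s + H (\<psi> s)) - (- \<phi> s + H (\<phi> s)))
          \<le> - (1/2) * ((\<psi> s - \<phi> s) \<bullet> (\<psi> s - \<phi> s))" by (rule diss)
    qed (rule t)
    then show ?thesis using \<phi>(1) \<psi>(2) by simp
  qed
  show ?thesis using sol \<phi>(1) uniq decay by blast
qed

section \<open>Local Lipschitz constants of C1 maps\<close>

text \<open>The continuous derivative vanishes at \<open>z\<close>, so its norm is below
  \<open>c\<close> nearby; the mean value inequality on a convex ball does the rest.\<close>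

lemma C1_on_lipschitz_near_critical_point:
  fixes h :: "'a::real_normed_vector \<Rightarrow> 'b::real_normed_vector"
  assumes "open S" "z \<in> S" "C1_on S h" "(h has_derivative (\<lambda>_. 0)) (at z)" "0 < c"
  shows "\<exists>\<rho>>0. cball z \<rho> \<subseteq> S \<and> c-lipschitz_on (cball z \<rho>) h"
proof -
  obtain h' where h': "\<And>x. x \<in> S \<Longrightarrow> (h has_derivative blinfun_apply (h' x)) (at x)"
    "continuous_on S h'"
    using assms(3) by (auto simp: C1_on_def)
  have "blinfun_apply (h' z) = (\<lambda>_. 0)"
    using has_derivative_unique[OF h'(1)[OF assms(2)] assms(4)] .
  then have z: "h' z = 0" by (auto intro: blinfun_eqI)
  have "isCont h' z" using h'(2) assms(1,2) continuous_on_eq_continuous_at by blast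
  then obtain d where d: "d > 0" "\<And>x. dist x z < d \<Longrightarrow> norm (h' x) < c"
    using \<open>0 < c\<close> unfolding continuous_at_eps_delta z by (auto simp: dist_norm)
  obtain e where e: "e > 0" "cball z e \<subseteq> S" using assms(1,2) open_contains_cball by blast
  define \<rho> where "\<rho> = min e (d / 2)"
  have \<rho>: "0 < \<rho>" "\<rho> < d" "cball z \<rho> \<subseteq> S" using d(1) e by (auto simp: \<rho>_def)
  have "c-lipschitz_on (cball z \<rho>) h"
  proof (rule lipschitz_onI)
    fix x y assume xy: "x \<in> cball z \<rho>" "y \<in> cball z \<rho>"
    have "norm (h x - h y) \<le> c * norm (x - y)"
    proof (rule differentiable_bound[OF convex_cball _ _ xy])
      fix u assume u: "u \<in> cball z \<rho>"
      then show "(h has_derivative blinfun_apply (h' u)) (at u within cball z \<rho>)"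
        using h'(1) \<rho>(3) by (meson has_derivative_at_withinI subsetD)
      show "onorm (blinfun_apply (h' u)) \<le> c"
        using d(2)[of u] u \<rho>(2) by (simp add: norm_blinfun.rep_eq dist_commute less_imp_le)
    qed
    then show "dist (h x) (h y) \<le> c * dist x y" by (simp add: dist_norm)
  qed (use assms in simp)
  then show ?thesis using \<rho> by blast
qed

section \<open>Matrix algebra of the feedback gain\<close>

lemma matrix_add_rdistrib:
  fixes A B :: "'a::semiring_1^'n^'m"
  shows "(A + B) ** C = A ** C + B ** C"
  by (vector matrix_matrix_mult_def sum.distrib[symmetric] distrib_right)

text \<open>Lets a vanishing quadratic form be read as membership in the kernel of
  \<open>transpose M\<close>.\<close>

lemma gramian_dot:
  fixes M :: "real^'m^'n"
  shows "y \<bullet> ((M ** transpose M) *v y) = (norm (transpose M *v y))\<^sup>2"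
proof -
  have "y \<bullet> ((M ** transpose M) *v y) = y \<bullet> (M *v (transpose M *v y))"
    by (simp only: matrix_vector_mul_assoc)
  also have "\<dots> = (y v* M) \<bullet> (transpose M *v y)" by (rule dot_lmul_matrix[symmetric])
  finally show ?thesis by (simp add: power2_norm_eq_inner)
qed

text \<open>Once \<open>B\<close> is onto, its pseudoinverse is a right inverse. Multiplying the
  bracketed factor by \<open>B\<close> and \<open>transpose B\<close> then produces exactly the
  matrix \<open>G\<close> whose inverse follows.\<close>

lemma semitransversal_closed_loop:
  fixes A :: "real^'n^'n" and B :: "real^'m^'n"
  assumes onto: "\<And>y. (\<And>x u. y \<bullet> (A *v x + B *v u) = 0) \<Longrightarrow> y = 0"
    and semi: "orth_proj ((kernel (transpose B))\<^sup>\<bottom>) ** (A ** transpose A)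
           ** orth_proj ((kernel (transpose B))\<^sup>\<bottom>) = A ** transpose A"
  shows "B ** ((pseudoinverse B ** (A ** transpose A) ** transpose (pseudoinverse B) + mat 1)
               ** transpose B ** matrix_inv (A ** transpose A + B ** transpose B) ** (mat 1 + A))
         = mat 1 + A"
proof -
  define P where "P = orth_proj ((kernel (transpose B))\<^sup>\<bottom>)"
  define G where "G = A ** transpose A + B ** transpose B"
  define X where "X = pseudoinverse B"
  have ker: "y = 0" if "transpose A *v y = 0" "transpose B *v y = 0" for y
    using that by (intro onto) (simp add: inner_add_right dot_lmul_matrix[symmetric])
  \<comment> \<open>By \<open>semi\<close>, \<open>A ** transpose A\<close> maps into the orthogonal
    complement of the kernel containing \<open>y\<close>, so its quadratic form vanishes at
    \<open>y\<close>. Injectivity of \<open>transpose B\<close> means that \<open>B\<close> is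
    onto.\<close>
  have kerB: "y = 0" if y: "transpose B *v y = 0" for y
  proof (rule ker[OF _ y])
    have "P *v (A ** transpose A ** P *v y) \<in> (kernel (transpose B))\<^sup>\<bottom>"
      unfolding P_def by (rule orth_proj_works) (rule subspace_orthogonal_comp)
    then have "(A ** transpose A) *v y \<in> (kernel (transpose B))\<^sup>\<bottom>"
      using semi by (simp add: P_def matrix_vector_mul_assoc matrix_mul_assoc)
    then have "y \<bullet> ((A ** transpose A) *v y) = 0"
      using y by (auto simp: orthogonal_comp_def orthogonal_def kernel_def)
    then show "transpose A *v y = 0" unfolding gramian_dot by simp
  qed
  have BXB: "B ** X ** B = B"
    using is_pseudoinverse_pseudoinverse[of B] by (simp add: is_pseudoinverse_def X_def)
  \<comment> \<open>Injectivity of \<open>transpose B\<close> allows cancelling it on the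
    left.\<close>
  have "transpose B ** transpose (B ** X) = transpose B"
    by (metis BXB matrix_transpose_mul)
  then have "transpose B *v (transpose (B ** X) *v y - y) = 0" for y
    by (simp add: matrix_vector_mult_diff_distrib matrix_vector_mul_assoc del: transpose_matrix_vector)
  then have "transpose (B ** X) *v y = y" for y using kerB eq_iff_diff_eq_0 by blast
  then have "transpose (B ** X) = mat 1" by (simp add: matrix_eq del: transpose_matrix_vector)
  then have BX: "B ** X = mat 1" "transpose X ** transpose B = mat 1"
    by (metis transpose_mat transpose_transpose, metis matrix_transpose_mul)
  \<comment> \<open>The quadratic form of \<open>G\<close> is a sum of two squares, so
    \<open>G\<close> is injective and, being square, invertible.\<close>
  have "y = 0" if "G *v y = 0" for y
  proof -
    have "(norm (transpose A *v y))\<^sup>2 + (norm (transpose B *v y))\<^sup>2 = y \<bullet> (G *v y)"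
      unfolding G_def gramian_dot[symmetric]
      by (simp only: matrix_vector_mult_add_rdistrib inner_add_right)
    then have "transpose B *v y = 0" using that by (simp add: add_nonneg_eq_0_iff)
    then show ?thesis by (rule kerB)
  qed
  then obtain G' where "G' ** G = mat 1" by (metis matrix_left_invertible_ker)
  then have "\<exists>G'. G ** G' = mat 1 \<and> G' ** G = mat 1" using matrix_left_right_inverse by blast
  \<comment> \<open>\<open>matrix_inv\<close> is a choice, meaningful only once a two-sided inverse
    is known to exist.\<close>
  then have inv: "G ** matrix_inv G = mat 1"
    unfolding matrix_inv_def by (rule someI2_ex) blast
  have "B ** (X ** (A ** transpose A) ** transpose X + mat 1) ** transpose B
      = (B ** X) ** (A ** transpose A) ** (transpose X ** transpose B) + B ** transpose B"
    by (simp add: matrix_add_ldistrib matrix_add_rdistrib matrix_mul_assoc)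
  also have "\<dots> = G" by (simp add: BX G_def)
  finally show ?thesis
    unfolding X_def[symmetric] G_def[symmetric] by (simp add: matrix_mul_assoc inv)
qed

section \<open>Linearization of the closed loop and conclusion\<close>

text \<open>The chain rule along the two coordinate slices identifies the partial derivatives;
  linearity of \<open>D\<close> adds them.\<close>

lemma jacobian_slices:
  fixes f :: "(real^'n) \<times> (real^'m) \<Rightarrow> real^'n"
  assumes "(f has_derivative D) (at (0, 0))"
  shows "D (x, u) = jacobian (\<lambda>x. f (x, 0)) (at 0) *v x + jacobian (\<lambda>u. f (0, u)) (at 0) *v u"
proof -
  have dx: "((\<lambda>x. f (x, 0)) has_derivative (\<lambda>x. D (x, 0))) (at 0)"
    by (rule has_derivative_compose[where g = f and f = "\<lambda>x. (x, 0)" and s = UNIV and g' = D and x = 0])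
       (auto intro!: derivative_eq_intros assms)
  have x: "jacobian (\<lambda>x. f (x, 0)) (at 0) *v x = D (x, 0)"
    unfolding jacobian_def frechet_derivative_at[OF dx, symmetric]
    using has_derivative_linear[OF dx] by simp
  have du: "((\<lambda>u. f (0, u)) has_derivative (\<lambda>u. D (0, u))) (at 0)"
    by (rule has_derivative_compose[where g = f and f = "\<lambda>u. (0, u)" and s = UNIV and g' = D and x = 0])
       (auto intro!: derivative_eq_intros assms)
  have u: "jacobian (\<lambda>u. f (0, u)) (at 0) *v u = D (0, u)"
    unfolding jacobian_def frechet_derivative_at[OF du, symmetric]
    using has_derivative_linear[OF du] by simp
  have "D ((x, 0) + (0, u)) = D (x, 0) + D (0, u)"
    by (rule linear_add[OF has_derivative_linear[OF assms]])
  then show ?thesis by (simp add: x u)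
qed

text \<open>With \<open>L\<close> the graph of the feedback, the map is the deviation of the closed
  loop from \<open>x' = - x\<close>.\<close>

lemma C1_on_linear_pullback_plus_id:
  fixes f :: "('a::real_normed_vector \<times> 'b::real_normed_vector) \<Rightarrow> 'a" and L :: "'a \<Rightarrow>\<^sub>L ('a \<times> 'b)"
  assumes "C1_on S f"
  shows "C1_on (blinfun_apply L -` S) (\<lambda>x. f (L x) + x)"
proof -
  obtain f' where f': "\<And>z. z \<in> S \<Longrightarrow> (f has_derivative blinfun_apply (f' z)) (at z)"
    "continuous_on S f'"
    using assms by (auto simp: C1_on_def)
  have "((\<lambda>x. f (L x) + x) has_derivative blinfun_apply ((f' (L x) o\<^sub>L L) + id_blinfun)) (at x)"
    if "L x \<in> S" for x
    using has_derivative_compose[OF blinfun.bounded_linear_right[THEN bounded_linear_imp_has_derivative] f'(1)[OF that]]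
    by (auto intro!: derivative_eq_intros simp: blinfun.add_left)
  moreover have "continuous_on (blinfun_apply L -` S) (\<lambda>x. (f' (L x) o\<^sub>L L) + id_blinfun)"
    by (intro continuous_intros continuous_on_compose2[OF f'(2)]) auto
  ultimately show ?thesis
    unfolding C1_on_def by (intro exI[of _ "\<lambda>x. (f' (L x) o\<^sub>L L) + id_blinfun"]) auto
qed

theorem theorem23:
  fixes U :: "(real^'n) set" and V :: "(real^'m) set"
    and f :: "(real^'n) \<times> (real^'m) \<Rightarrow> real^'n"
    and A :: "real^'n^'n" and B :: "real^'m^'n"
  assumes "open (U \<times> V)" and "(0, 0) \<in> U \<times> V"
    and "C1_on (U \<times> V) f" and "f (0, 0) = 0"
    and "A = jacobian (\<lambda>x. f (x, 0)) (at 0)"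
    and "B = jacobian (\<lambda>u. f (0, u)) (at 0)"
    and "cov (U \<times> V) f (0, 0) > 0"
    and "orth_proj ((kernel (transpose B))\<^sup>\<bottom>) ** (A ** transpose A)
           ** orth_proj ((kernel (transpose B))\<^sup>\<bottom>) = A ** transpose A"
  shows "locally_exp_stabilizable U V f \<and>
    exp_stabilizes U V f
      (\<lambda>x. - (((pseudoinverse B ** (A ** transpose A) ** transpose (pseudoinverse B) + mat 1)
               ** transpose B
               ** matrix_inv (A ** transpose A + B ** transpose B)
               ** (mat 1 + A)) *v x))"
proof -
  define K where "K = (pseudoinverse B ** (A ** transpose A) ** transpose (pseudoinverse B) + mat 1)
               ** transpose B ** matrix_inv (A ** transpose A + B ** transpose B) ** (mat 1 + A)"
  obtain D where D: "(f has_derivative D) (at (0, 0))"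
    using assms(2,3) by (auto simp: C1_on_def)
  have D_eq: "D (x, u) = A *v x + B *v u" for x u
    using jacobian_slices[OF D] by (simp add: assms(5,6))
  obtain \<kappa> where "linearly_open_around (U \<times> V) f (0, 0) \<kappa>"
    using cov_pos_imp_linearly_open[OF assms(7)] by blast
  then have onto: "y = 0" if "\<And>x u. y \<bullet> (A *v x + B *v u) = 0" for y
    using linearly_open_orthogonal_range[OF _ D, of _ _ y] that by (auto simp: D_eq)
  \<comment> \<open>Equivalently \<open>A - B ** K = - mat 1\<close>.\<close>
  have BK: "B ** K = mat 1 + A"
    unfolding K_def by (rule semitransversal_closed_loop[OF onto assms(8)])
  define L where "L = Blinfun (\<lambda>x. (x, - (K *v x)))"
  have L: "blinfun_apply L = (\<lambda>x. (x, - (K *v x)))"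
    unfolding L_def
    by (intro bounded_linear_Blinfun_apply bounded_linear_Pair bounded_linear_minus
        bounded_linear_ident matrix_vector_mul_bounded_linear)
  define F where "F = (\<lambda>x. f (x, - (K *v x)))"
  define S where "S = blinfun_apply L -` (U \<times> V)"
  have "open S" unfolding S_def
    by (intro open_vimage assms(1) continuous_intros)
  have "0 \<in> S" using assms(2) by (simp add: S_def L)
  have "C1_on S (\<lambda>x. F x + x)"
    using C1_on_linear_pullback_plus_id[OF assms(3), of L] by (simp add: S_def F_def L)
  moreover have "((\<lambda>x. F x + x) has_derivative (\<lambda>_. 0)) (at 0)"
  proof -
    have "(f has_derivative D) (at (L 0))" using D by (simp add: L)
    then have "((\<lambda>x. f (L x) + x) has_derivative (\<lambda>x. D (L x) + x)) (at 0)"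
      by (intro has_derivative_add has_derivative_ident
          has_derivative_compose[OF bounded_linear_imp_has_derivative[OF blinfun.bounded_linear_right]])
    moreover have "D (L x) + x = 0" for x
    proof -
      have "B *v (K *v x) = x + A *v x"
        by (simp add: matrix_vector_mul_assoc BK matrix_vector_mult_add_rdistrib)
      then show ?thesis
        using linear_neg[OF matrix_vector_mul_linear, of B "K *v x"] by (simp add: L D_eq)
    qed
    ultimately show ?thesis by (simp add: F_def L)
  qed
  \<comment> \<open>The constant \<open>1/2\<close> is small enough for a contraction and leaves
    half of the unit decay rate.\<close>
  ultimately obtain \<rho> where \<rho>: "\<rho> > 0" "cball 0 \<rho> \<subseteq> S" "(1/2)-lipschitz_on (cball 0 \<rho>) (\<lambda>x. F x + x)"
    using C1_on_lipschitz_near_critical_point[OF \<open>open S\<close> \<open>0 \<in> S\<close>, of "\<lambda>x. F x + x" "1/2"] by auto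
  have sub: "ball 0 \<rho> \<subseteq> U" "(\<lambda>x. - (K *v x)) ` ball 0 \<rho> \<subseteq> V"
    using subset_trans[OF ball_subset_cball \<rho>(2)] by (auto simp: S_def L subset_iff)
  have "bounded_linear (\<lambda>x. - (K *v x))"
    by (intro bounded_linear_minus matrix_vector_mul_bounded_linear)
  then have "C1_on (ball 0 \<rho>) (\<lambda>x. - (K *v x))"
    unfolding C1_on_def
    by (intro exI[of _ "\<lambda>_. Blinfun (\<lambda>x. - (K *v x))"])
       (auto simp: bounded_linear_Blinfun_apply intro: bounded_linear_imp_has_derivative)
  moreover have "F 0 = 0" using assms(4) by (simp add: F_def)
  \<comment> \<open>Witnesses: \<alpha> is \<open>1/2\<close>, \<open>M\<close> is \<open>1\<close>,
    and \<open>\<rho>\<close> is both \<delta> and the radius of \<open>N\<close>.\<close>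
  ultimately have "exp_stabilizes U V f (\<lambda>x. - (K *v x))"
    unfolding exp_stabilizes_def
    using sub \<rho>(1) exp_stable_near_minus_identity[OF \<rho>(3)]
    by (intro exI[of _ "ball 0 \<rho>"] conjI exI[of _ "1/2 :: real"] exI[of _ "1 :: real"] exI[of _ \<rho>])
       (auto simp: F_def)
  then show ?thesis
    unfolding locally_exp_stabilizable_def K_def by blast
qed

end
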